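(* There exist homogeneous links which are not the closure of any Artin-homogeneous braid (on any number of strands).
   Context: **Homogeneous links.** Let $D$ be an oriented diagram of a link. Applying Seifert's algorithm to $D$ yields a surface $S_D$ consisting of Seifert discs joined by bands, one for each crossing. The Seifert graph $G_D$ has one vertex for each Seifert disc and one edge for each band (joining the vertices of the discs connected by that band), labelled with the sign $+$ or $-$ of the corresponding crossing of $D$. A vertex $v$ of a connected graph $G$ is a cut vertex if $G\setminus\{v\}$ is disconnected; cutting $G$ at all its cut vertices produces connected subgraphs without cut vertices, called the blocks of $G$ (for a disconnected graph, the blocks are those of its components). A Seifert graph is homogeneous if, for every block, all edges of the block have the same sign. An oriented diagram is homogeneous if its Seifert graph is homogeneous, and a link is homogeneous if it has a homogeneous diagram. **Artin-homogeneous braids.** Let $\sigma_1,\dots,\sigma_{n-1}$ be the standard Artin generators of the braid group $B_n$. A word in the $\sigma_i^{\pm1}$ is homogeneous if for each $i$ the exponents of all occurrences of $\sigma_i$ have the same sign. A braid is Artin-homogeneous if it can be represented by such a homogeneous word. *)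

theory Defs
  imports Main "HOL-Library.Multiset"
begin

section \<open>Oriented link diagrams\<close>

text \<open>
  A diagram on the sphere is encoded by a planar diagram code: the oriented arcs are labelled by
  natural numbers, and a node says how arcs meet.  In \<open>Crossing s a b c d\<close> the overpassing strand
  enters along \<open>a\<close> and leaves along \<open>b\<close>, the underpassing strand enters along \<open>c\<close> and leaves
  along \<open>d\<close>, and \<open>s\<close> is true iff the crossing is positive.  A \<open>Joint a b\<close> is a marked point where
  the strand passes from arc \<open>a\<close> to arc \<open>b\<close>; it has no geometric meaning, but allows a circle
  without crossings to be written as \<open>Joint a a\<close>.
\<close>

datatype 'a node = Crossing bool 'a 'a 'a 'a | Joint 'a 'a

type_synonym diagram = "nat node multiset"

fun arcs_into :: "'a node \<Rightarrow> 'a multiset" where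
  "arcs_into (Crossing s a b c d) = {#a, c#}"
| "arcs_into (Joint a b) = {#a#}"

fun arcs_out_of :: "'a node \<Rightarrow> 'a multiset" where
  "arcs_out_of (Crossing s a b c d) = {#b, d#}"
| "arcs_out_of (Joint a b) = {#b#}"

definition heads :: "diagram \<Rightarrow> nat multiset" where
  "heads D = (\<Sum>x\<in>#D. arcs_into x)"

definition tails :: "diagram \<Rightarrow> nat multiset" where
  "tails D = (\<Sum>x\<in>#D. arcs_out_of x)"

definition arcs :: "diagram \<Rightarrow> nat set" where
  "arcs D = set_mset (heads D)"

definition well_formed :: "diagram \<Rightarrow> bool" where
  "well_formed D \<longleftrightarrow> heads D = tails D \<and> (\<forall>a. count (heads D) a \<le> 1)"

text \<open>The classes of the equivalence relation on \<open>A\<close> generated by \<open>r\<close>.\<close>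

definition classes :: "'b set \<Rightarrow> ('b \<times> 'b) set \<Rightarrow> 'b set set" where
  "classes A r = A // ((r \<union> r\<inverse>)\<^sup>* \<inter> A \<times> A)"

text \<open>
  The ends of the arcs at a node, in counterclockwise order; \<open>(a, True)\<close> is the head of \<open>a\<close> and
  \<open>(a, False)\<close> its tail.  The sign of a crossing decides on which side of the overpassing strand
  the underpassing strand enters.
\<close>

fun rim :: "'a node \<Rightarrow> ('a \<times> bool) list" where
  "rim (Crossing True a b c d) = [(a, True), (c, True), (b, False), (d, False)]"
| "rim (Crossing False a b c d) = [(a, True), (d, False), (b, False), (c, True)]"
| "rim (Joint a b) = [(a, True), (b, False)]"

text \<open>
  Going along an arc from one end to the other and then to the next arc end at that node in
  counterclockwise order traces out the boundaries of the faces.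
\<close>

definition face_step :: "diagram \<Rightarrow> ((nat \<times> bool) \<times> (nat \<times> bool)) set" where
  "face_step D = {((a, h), rim x ! (Suc i mod length (rim x))) | a h x i.
     x \<in># D \<and> i < length (rim x) \<and> rim x ! i = (a, \<not> h)}"

definition faces :: "diagram \<Rightarrow> (nat \<times> bool) set set" where
  "faces D = classes (arcs D \<times> UNIV) (face_step D)"

definition meets :: "diagram \<Rightarrow> (nat \<times> nat) set" where
  "meets D = {(a, b). \<exists>x. x \<in># D \<and> a \<in># arcs_into x + arcs_out_of x
                                \<and> b \<in># arcs_into x + arcs_out_of x}"

definition diagram_components :: "diagram \<Rightarrow> nat set set" where
  "diagram_components D = classes (arcs D) (meets D)"

text \<open>
  Euler's formula \<open>V - E + F = 2 C\<close>, where faces are counted separately for each of the \<open>C\<close>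
  connected components: every component has genus zero.  The relative position of different
  components on the sphere is not recorded; it affects neither the link nor the Seifert graph.
\<close>

definition planar :: "diagram \<Rightarrow> bool" where
  "planar D \<longleftrightarrow>
     size D + card (faces D) = card (arcs D) + 2 * card (diagram_components D)"

definition oriented_diagram :: "diagram \<Rightarrow> bool" where
  "oriented_diagram D \<longleftrightarrow> D \<noteq> {#} \<and> well_formed D \<and> planar D"


section \<open>Links\<close>

text \<open>
  The part of a diagram in which an upper strand \<open>a1, a2, a3\<close>, a middle strand \<open>b1, b2, b3\<close> and a
  lower strand \<open>c1, c2, c3\<close> form a triangle.  The signs of the upper-middle, upper-lower and
  middle-lower crossings are \<open>s\<close>, \<open>t\<close>, \<open>u\<close>, and \<open>k\<close> says on which side of the lower strand the
  upper-middle crossing lies.  For straight strands with directions \<open>A\<close>, \<open>B\<close>, \<open>C\<close> the signs are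
  those of the determinants \<open>det A B\<close>, \<open>det A C\<close>, \<open>det B C\<close>.  The upper-middle crossing is the first
  one on the upper strand iff \<open>k = t\<close>, and the first one on the middle strand iff \<open>k = u\<close>; the
  upper-lower crossing is the first one on the lower strand iff the product of all four signs is
  positive.
\<close>

definition triangle ::
  "bool \<Rightarrow> bool \<Rightarrow> bool \<Rightarrow> bool \<Rightarrow> nat \<Rightarrow> nat \<Rightarrow> nat \<Rightarrow> nat \<Rightarrow> nat \<Rightarrow> nat \<Rightarrow> nat \<Rightarrow> nat \<Rightarrow> nat \<Rightarrow> diagram"
where
  "triangle k s t u a1 a2 a3 b1 b2 b3 c1 c2 c3 =
    (let upper = (\<lambda>first. if first then (a1, a2) else (a2, a3));
         middle = (\<lambda>first. if first then (b1, b2) else (b2, b3));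
         lower = (\<lambda>first. if first then (c1, c2) else (c2, c3));
         crossing = (\<lambda>s (a, b) (c, d). Crossing s a b c d);
         p = (k = t); q = (k = u); r = ((k = s) = (t = u))
     in {# crossing s (upper p) (middle q),
           crossing t (upper (\<not> p)) (lower r),
           crossing u (middle (\<not> q)) (lower (\<not> r)) #})"

inductive reidemeister :: "diagram \<Rightarrow> diagram \<Rightarrow> bool" where
  R1_over: "reidemeister {#Crossing s a e e b#} {#Joint a b#}"
| R1_under: "reidemeister {#Crossing s e b a e#} {#Joint a b#}"
| R2_parallel:
    "reidemeister {#Crossing s a b p q, Crossing (\<not> s) b c q r#} {#Joint a c, Joint p r#}"
| R2_antiparallel:
    "reidemeister {#Crossing s a b q r, Crossing (\<not> s) b c p q#} {#Joint a c, Joint p r#}"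
| R3:
    "reidemeister (triangle True s t u a1 a2 a3 b1 b2 b3 c1 c2 c3)
                  (triangle False s t u a1 a2 a3 b1 b2 b3 c1 c2 c3)"

inductive diagram_move :: "diagram \<Rightarrow> diagram \<Rightarrow> bool" where
  reidemeister_move: "reidemeister L L' \<Longrightarrow> diagram_move (L + R) (L' + R)"
| remove_joint: "a \<noteq> b \<Longrightarrow>
    diagram_move (add_mset (Joint a b) R) (image_mset (map_node (\<lambda>x. if x = b then a else x)) R)"
| relabel: "inj_on f (arcs D) \<Longrightarrow> diagram_move D (image_mset (map_node f) D)"

text \<open>
  Every intermediate diagram has to be planar.  This is what confines the creation of two crossings
  by an inverse second move to arcs on a common face.
\<close>

definition same_link :: "diagram \<Rightarrow> diagram \<Rightarrow> bool" where
  "same_link = equivclp (\<lambda>D D'. oriented_diagram D \<and> oriented_diagram D' \<and> diagram_move D D')"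

text \<open>An oriented link is represented by the set of all its diagrams.\<close>

type_synonym link = "diagram set"

definition link_of :: "diagram \<Rightarrow> link" where
  "link_of D = {D'. oriented_diagram D' \<and> same_link D D'}"

definition oriented_links :: "link set" where
  "oriented_links = link_of ` Collect oriented_diagram"


section \<open>Blocks of graphs\<close>

text \<open>Undirected graphs with multiple edges; \<open>ends G e\<close> is the set of the end vertices of \<open>e\<close>.\<close>

record ('v, 'e) graph =
  verts :: "'v set"
  edges :: "'e set"
  ends :: "'e \<Rightarrow> 'v set"

definition adjacent :: "('v, 'e) graph \<Rightarrow> ('v \<times> 'v) set" where
  "adjacent G = {(u, v). \<exists>e\<in>edges G. ends G e = {u, v}}"

definition component_sets :: "('v, 'e) graph \<Rightarrow> 'v set set" where
  "component_sets G = classes (verts G) (adjacent G)"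

definition connected_graph :: "('v, 'e) graph \<Rightarrow> bool" where
  "connected_graph G \<longleftrightarrow> (\<forall>u\<in>verts G. \<forall>v\<in>verts G. (u, v) \<in> (adjacent G)\<^sup>*)"

definition induced :: "('v, 'e) graph \<Rightarrow> 'v set \<Rightarrow> ('v, 'e) graph" where
  "induced G S = \<lparr>verts = S, edges = {e \<in> edges G. ends G e \<subseteq> S}, ends = ends G\<rparr>"

definition delete_vertex :: "('v, 'e) graph \<Rightarrow> 'v \<Rightarrow> ('v, 'e) graph" where
  "delete_vertex G v = induced G (verts G - {v})"

definition cut_vertex :: "('v, 'e) graph \<Rightarrow> 'v \<Rightarrow> bool" where
  "cut_vertex G v \<longleftrightarrow> v \<in> verts G \<and> \<not> connected_graph (delete_vertex G v)"

text \<open>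
  Cutting a connected loopless graph at all its cut vertices: a cut vertex \<open>v\<close> is replaced by one
  copy \<open>(v, K)\<close> for each component \<open>K\<close> of the graph without \<open>v\<close>, and an edge from \<open>v\<close> into \<open>K\<close>
  is attached to that copy.  Other vertices have a single copy.
\<close>

definition copies :: "('v, 'e) graph \<Rightarrow> 'v \<Rightarrow> 'v set set" where
  "copies G v = (if cut_vertex G v then component_sets (delete_vertex G v) else {verts G})"

definition cut_graph :: "('v, 'e) graph \<Rightarrow> ('v \<times> 'v set, 'e) graph" where
  "cut_graph G =
     \<lparr>verts = {(v, K). v \<in> verts G \<and> K \<in> copies G v},
      edges = edges G,
      ends = (\<lambda>e. {(v, K). v \<in> ends G e \<and> K \<in> copies G v \<and> ends G e - {v} \<subseteq> K})\<rparr>"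

definition blocks_of_connected :: "('v, 'e) graph \<Rightarrow> ('v, 'e) graph set" where
  "blocks_of_connected G =
     (\<lambda>S. \<lparr>verts = fst ` S, edges = {e \<in> edges G. ends (cut_graph G) e \<subseteq> S}, ends = ends G\<rparr>)
       ` component_sets (cut_graph G)"

definition blocks :: "('v, 'e) graph \<Rightarrow> ('v, 'e) graph set" where
  "blocks G = (\<Union>S\<in>component_sets G. blocks_of_connected (induced G S))"


section \<open>Homogeneous links\<close>

text \<open>
  Seifert's algorithm smooths every crossing in the way compatible with the orientations: each
  incoming strand continues along the outgoing arc of the other strand.  A Seifert disc is
  represented by the set of arcs of its boundary circle.
\<close>

definition smoothing :: "diagram \<Rightarrow> (nat \<times> nat) set" where
  "smoothing D =
     {(a, d) | s a b c d. Crossing s a b c d \<in># D} \<union>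
     {(c, b) | s a b c d. Crossing s a b c d \<in># D} \<union>
     {(a, b) | a b. Joint a b \<in># D}"

definition seifert_discs :: "diagram \<Rightarrow> nat set set" where
  "seifert_discs D = classes (arcs D) (smoothing D)"

fun is_crossing :: "'a node \<Rightarrow> bool" where
  "is_crossing (Crossing s a b c d) = True"
| "is_crossing (Joint a b) = False"

fun positive :: "'a node \<Rightarrow> bool" where
  "positive (Crossing s a b c d) = s"
| "positive (Joint a b) = undefined"

definition seifert_graph :: "diagram \<Rightarrow> (nat set, nat node) graph" where
  "seifert_graph D =
     \<lparr>verts = seifert_discs D,
      edges = {x. x \<in># D \<and> is_crossing x},
      ends = (\<lambda>x. {S \<in> seifert_discs D. S \<inter> set_mset (arcs_into x) \<noteq> {}})\<rparr>"

definition homogeneous_diagram :: "diagram \<Rightarrow> bool" where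
  "homogeneous_diagram D \<longleftrightarrow> oriented_diagram D \<and>
     (\<forall>B\<in>blocks (seifert_graph D). \<forall>x\<in>edges B. \<forall>y\<in>edges B. positive x = positive y)"

definition homogeneous_link :: "link \<Rightarrow> bool" where
  "homogeneous_link L \<longleftrightarrow> L \<in> oriented_links \<and> (\<exists>D\<in>L. homogeneous_diagram D)"


section \<open>Braids\<close>

text \<open>\<open>(i, True)\<close> stands for the Artin generator with index \<open>i\<close>, \<open>(i, False)\<close> for its inverse.\<close>

type_synonym braid_word = "(nat \<times> bool) list"

definition braid_words :: "nat \<Rightarrow> braid_word set" where
  "braid_words n = {w. \<forall>(i, s)\<in>set w. 1 \<le> i \<and> i < n}"

inductive braid_relation :: "nat \<Rightarrow> braid_word \<Rightarrow> braid_word \<Rightarrow> bool" for n where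
  cancel: "1 \<le> i \<Longrightarrow> i < n \<Longrightarrow> braid_relation n (u @ [(i, s), (i, \<not> s)] @ v) (u @ v)"
| commute: "1 \<le> i \<Longrightarrow> i + 2 \<le> j \<Longrightarrow> j < n \<Longrightarrow>
    braid_relation n (u @ [(i, True), (j, True)] @ v) (u @ [(j, True), (i, True)] @ v)"
| braid: "1 \<le> i \<Longrightarrow> i + 1 < n \<Longrightarrow>
    braid_relation n (u @ [(i, True), (i + 1, True), (i, True)] @ v)
                     (u @ [(i + 1, True), (i, True), (i + 1, True)] @ v)"

text \<open>The elements of the braid group on \<open>n\<close> strands.\<close>

definition braids :: "nat \<Rightarrow> braid_word set set" where
  "braids n = braid_words n //
     {(v, w). v \<in> braid_words n \<and> w \<in> braid_words n \<and> equivclp (braid_relation n) v w}"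

definition homogeneous_word :: "braid_word \<Rightarrow> bool" where
  "homogeneous_word w \<longleftrightarrow> (\<forall>i s t. (i, s) \<in> set w \<longrightarrow> (i, t) \<in> set w \<longrightarrow> s = t)"

definition artin_homogeneous :: "braid_word set \<Rightarrow> bool" where
  "artin_homogeneous \<beta> \<longleftrightarrow> (\<exists>w\<in>\<beta>. homogeneous_word w)"

text \<open>
  All strands run upwards; the arc at position \<open>p\<close> (with \<open>1 \<le> p \<le> n\<close>, from left to right) just
  before letter \<open>l\<close> of the word is labelled \<open>l * n + p\<close>.
\<close>

fun braid_layer :: "nat \<Rightarrow> nat \<Rightarrow> nat \<times> bool \<Rightarrow> diagram" where
  "braid_layer n l (i, s) =
     (let arc = (\<lambda>l p. l * n + p)
      in add_mset
          (if s then Crossing True (arc l i) (arc (l + 1) (i + 1)) (arc l (i + 1)) (arc (l + 1) i)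
           else Crossing False (arc l (i + 1)) (arc (l + 1) i) (arc l i) (arc (l + 1) (i + 1)))
          {# Joint (arc l p) (arc (l + 1) p). p \<in># mset_set ({1..n} - {i, i + 1}) #})"

definition closure_diagram :: "nat \<Rightarrow> braid_word \<Rightarrow> diagram" where
  "closure_diagram n w =
     (\<Sum>l\<in>#mset_set {..<length w}. braid_layer n l (w ! l)) +
     {# Joint (length w * n + p) p. p \<in># mset_set {1..n} #}"

text \<open>The closures of all words representing a braid are diagrams of one link, so this union of equal
  sets lifts the closure from words to braids.\<close>

definition braid_closure :: "nat \<Rightarrow> braid_word set \<Rightarrow> link" where
  "braid_closure n \<beta> = (\<Union>w\<in>\<beta>. link_of (closure_diagram n w))"

end

theory Submission
  imports Defs "HOL-Library.Z2" "HOL-Computational_Algebra.Formal_Laurent_Series"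
begin

text \<open>
  The link is the boundary of an annulus with two full twists: two antiparallel strands that cross
  each other four times, always positively.  Its diagram is homogeneous because all its signs agree.

  What distinguishes it is its Alexander polynomial \<open>2 (t - 1)\<close>, which vanishes modulo two although
  the link is not split.  The closure of a homogeneous braid word that uses every generator has an
  Alexander polynomial with extreme coefficients \<open>1\<close> or \<open>-1\<close>, so that it survives every reduction;
  the closure of a word that omits a generator is split, so its polynomial is zero over the rationals
  too.  The proof sees the polynomial through colorings.  For a field with a nonzero element \<open>t\<close> one
  colors the arcs by elements of the field so that an arc \<open>c\<close> passing under \<open>a\<close> continues as
  \<open>t c + (1 - t) a\<close> at a positive crossing, with the inverse rule at a negative one.  The Alexander
  polynomial vanishes at \<open>t\<close> iff some coloring is not constant.  Whether all colorings are constant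
  (\<open>monochromatic\<close>) is unchanged by the diagram moves (\<open>same_link_monochromatic\<close>), because the
  colors form a quandle.

  Colorings of a closed braid are the vectors fixed by its Burau matrix
  (\<open>monochromatic_closure_iff\<close>).  Two fields decide the theorem.
  Over the Laurent series in \<open>t\<close> over the field with two elements the twisted annulus has a
  nonconstant coloring, but a homogeneous word with all generators does not: the differences between
  the colors of neighbouring strands turn out to be divisible by every power of \<open>t\<close>
  (\<open>full_homogeneous_fixed_constant\<close>).
  Over the rationals with \<open>t = -1\<close> the twisted annulus has only constant colorings, but a word that
  omits a generator has others, since the strands on the two sides of the gap can be colored
  independently (\<open>burau_missing_generator\<close>).
\<close>

section \<open>Coloring diagrams by the Alexander quandle\<close>

definition pass_under :: "'k::field \<Rightarrow> bool \<Rightarrow> 'k \<Rightarrow> 'k \<Rightarrow> 'k" where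
  "pass_under t s a c = (if s then t * c + (1 - t) * a else (c - (1 - t) * a) / t)"

text \<open>
  These identities are the axioms of a quandle: idempotence makes colorings compatible with the first
  Reidemeister move, invertibility with the second, and self-distributivity with the third.
\<close>

lemma pass_under_same: "t \<noteq> 0 \<Longrightarrow> pass_under t s a a = a"
  by (simp add: pass_under_def field_simps)

lemma pass_under_inverse: "t \<noteq> 0 \<Longrightarrow> pass_under t (\<not> s) a (pass_under t s a c) = c"
  by (simp add: pass_under_def field_simps)

lemma pass_under_distrib:
  "t \<noteq> 0 \<Longrightarrow>
    pass_under t s a (pass_under t u b c) = pass_under t u (pass_under t s a b) (pass_under t s a c)"
  by (cases s; cases u) (simp_all add: pass_under_def field_simps)

lemma pass_under_swap:
  assumes "t \<noteq> 0"
  shows "pass_under t s a c = d \<longleftrightarrow> c = pass_under t (\<not> s) a d"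
  using pass_under_inverse[OF assms, of s a c] pass_under_inverse[OF assms, of "\<not> s" a d] by auto

lemma pass_under_eq_over:
  assumes "t \<noteq> 0"
  shows "pass_under t s a c = a \<longleftrightarrow> c = a" "a = pass_under t s a c \<longleftrightarrow> c = a"
  using pass_under_swap[OF assms, of s a c a] by (auto simp: pass_under_same assms)

lemma pass_under_inverse':
  "t \<noteq> 0 \<Longrightarrow> pass_under t s a (pass_under t (\<not> s) a c) = c"
  using pass_under_inverse[of t "\<not> s"] by simp

fun node_rule :: "'k::field \<Rightarrow> (nat \<Rightarrow> 'k) \<Rightarrow> nat node \<Rightarrow> bool" where
  "node_rule t x (Crossing s a b c d) \<longleftrightarrow> x b = x a \<and> x d = pass_under t s (x a) (x c)"
| "node_rule t x (Joint a b) \<longleftrightarrow> x b = x a"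

definition coloring :: "'k::field \<Rightarrow> diagram \<Rightarrow> (nat \<Rightarrow> 'k) \<Rightarrow> bool" where
  "coloring t D x \<longleftrightarrow> (\<forall>N\<in>#D. node_rule t x N)"

text \<open>
  For nonzero \<open>t\<close> every constant function is a coloring; that there are no others means that the
  Alexander polynomial does not vanish at \<open>t\<close>.
\<close>

definition monochromatic :: "'k::field \<Rightarrow> diagram \<Rightarrow> bool" where
  "monochromatic t D \<longleftrightarrow> (\<forall>x. coloring t D x \<longrightarrow> (\<exists>k. \<forall>a\<in>arcs D. x a = k))"

lemma coloring_add_mset [simp]: "coloring t (add_mset N D) x \<longleftrightarrow> node_rule t x N \<and> coloring t D x"
  and coloring_plus [simp]: "coloring t (D + D') x \<longleftrightarrow> coloring t D x \<and> coloring t D' x"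
  and coloring_empty [simp]: "coloring t {#} x"
  by (auto simp: coloring_def)

lemma heads_simps [simp]:
  "heads {#} = {#}" "heads (add_mset N D) = arcs_into N + heads D" "heads (D + D') = heads D + heads D'"
  by (simp_all add: heads_def)

lemma tails_simps [simp]:
  "tails {#} = {#}" "tails (add_mset N D) = arcs_out_of N + tails D" "tails (D + D') = tails D + tails D'"
  by (simp_all add: tails_def)

lemma coloring_cong:
  assumes "\<And>a. a \<in># heads D \<or> a \<in># tails D \<Longrightarrow> x a = y a"
  shows "coloring t D x \<longleftrightarrow> coloring t D y"
proof -
  have "node_rule t x N \<longleftrightarrow> node_rule t y N" if "N \<in># D" for N
  proof -
    have "\<forall>a\<in>#arcs_into N + arcs_out_of N. x a = y a"
      using that assms by (auto simp: heads_def tails_def)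
    then show ?thesis by (cases N) auto
  qed
  then show ?thesis by (auto simp: coloring_def)
qed

lemma coloring_fun_upd [simp]:
  "e \<notin># heads D \<Longrightarrow> e \<notin># tails D \<Longrightarrow> coloring t D (x(e := y)) \<longleftrightarrow> coloring t D x"
  by (rule coloring_cong) auto

text \<open>
  In a well-formed diagram no arc is head or tail twice.  An arc that lies inside a move is thus
  absent from the rest of the diagram and can be recolored freely.
\<close>

definition multiplicity_free :: "'b multiset \<Rightarrow> bool" where
  "multiplicity_free M \<longleftrightarrow> (\<forall>a. count M a \<le> 1)"

lemma multiplicity_free_add_mset [simp]:
  "multiplicity_free (add_mset a M) \<longleftrightarrow> a \<notin># M \<and> multiplicity_free M"
proof
  assume "multiplicity_free (add_mset a M)"
  then have free: "count (add_mset a M) c \<le> 1" for c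
    by (simp only: multiplicity_free_def)
  have "count M c \<le> 1" for c
    using free[of c] by (cases "c = a") simp_all
  moreover have "count M a = 0"
    using free[of a] by simp
  ultimately show "a \<notin># M \<and> multiplicity_free M"
    by (simp add: multiplicity_free_def not_in_iff)
next
  assume "a \<notin># M \<and> multiplicity_free M"
  then show "multiplicity_free (add_mset a M)"
    by (simp add: multiplicity_free_def not_in_iff)
qed

lemma multiplicity_free_empty [simp]: "multiplicity_free {#}"
  by (simp add: multiplicity_free_def)

lemma well_formed_distinct:
  assumes "well_formed D"
  shows "multiplicity_free (heads D)" "multiplicity_free (tails D)"
  using assms by (auto simp: well_formed_def multiplicity_free_def)

section \<open>Invariance under diagram moves\<close>

text \<open>
  The form in which a move transports colorings: the coloring \<open>x\<close> of \<open>D\<close> yields one of \<open>D'\<close> that is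
  constant only if \<open>x\<close> is.
\<close>

definition recolorable :: "'k::field \<Rightarrow> diagram \<Rightarrow> diagram \<Rightarrow> (nat \<Rightarrow> 'k) \<Rightarrow> bool" where
  "recolorable t D D' x \<longleftrightarrow> (\<exists>x'. coloring t D' x' \<and>
    (\<forall>k. (\<forall>a\<in>arcs D'. x' a = k) \<longrightarrow> (\<forall>a\<in>arcs D. x a = k)))"

text \<open>
  The middle strand has color \<open>x b2\<close> where it crosses the lower one, whichever of its two crossings
  comes first.  This is why \<open>b2\<close> is the only color of the middle strand in the last conditional.
\<close>

lemma coloring_triangle:
  "coloring t (triangle k s p u a1 a2 a3 b1 b2 b3 c1 c2 c3) x \<longleftrightarrow>
    x a2 = x a1 \<and> x a3 = x a1 \<and>
    (if k = u then x b2 = pass_under t s (x a1) (x b1) \<and> x b3 = x b2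
     else x b2 = x b1 \<and> x b3 = pass_under t s (x a1) (x b1)) \<and>
    (if (k = s) = (p = u) then x c2 = pass_under t p (x a1) (x c1) \<and> x c3 = pass_under t u (x b2) (x c2)
     else x c2 = pass_under t u (x b2) (x c1) \<and> x c3 = pass_under t p (x a1) (x c2))"
  unfolding triangle_def Let_def
  by (cases k; cases s; cases p; cases u) auto

lemma heads_triangle:
  "heads (triangle k s p u a1 a2 a3 b1 b2 b3 c1 c2 c3) = {#a1, a2, b1, b2, c1, c2#}"
  unfolding triangle_def Let_def
  by (cases k; cases s; cases p; cases u) (simp_all add: add_mset_commute)

lemma tails_triangle:
  "tails (triangle k s p u a1 a2 a3 b1 b2 b3 c1 c2 c3) = {#a2, a3, b2, b3, c2, c3#}"
  unfolding triangle_def Let_def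
  by (cases k; cases s; cases p; cases u) (simp_all add: add_mset_commute)

text \<open>
  Moving the lower strand across the upper-middle crossing changes only the colors of the
  inner arcs \<open>b2\<close> and \<open>c2\<close>, to \<open>b\<close> and \<open>c\<close>.  The lower strand leaves with the same color as before by
  self-distributivity.
\<close>

lemma triangle_recolorable:
  assumes t: "t \<noteq> 0"
    and T: "T = triangle k s p u a1 a2 a3 b1 b2 b3 c1 c2 c3"
      "T' = triangle (\<not> k) s p u a1 a2 a3 b1 b2 b3 c1 c2 c3"
    and free: "multiplicity_free (heads (T + R))" "multiplicity_free (tails (T + R))"
    and x: "coloring t (T + R) x"
  shows "recolorable t (T + R) (T' + R) x"
proof -
  define r where "r \<longleftrightarrow> (k = s) = (p = u)"
  define b where "b = (if k = u then x b1 else x b3)"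
  define c where "c = (if r then pass_under t u b (x c1) else pass_under t p (x a1) (x c1))"
  let ?x = "x(b2 := b, c2 := c)"
  from free have distinct: "b2 \<notin> {a1, a2, a3, b1, b3, c1, c2, c3}" "c2 \<notin> {a1, a2, a3, b1, b3, c1, c3}"
    and notin: "b2 \<notin># heads R" "b2 \<notin># tails R" "c2 \<notin># heads R" "c2 \<notin># tails R"
    by (auto simp: T heads_triangle tails_triangle)
  have colT: "coloring t T x" and colR: "coloring t R x"
    using x by auto
  note colT' = colT[unfolded T coloring_triangle, folded r_def]
  \<comment> \<open>the old and the new middle color differ by passing under the upper strand; the direction depends on \<open>k = u\<close>\<close>
  have middle: "if k = u then x b2 = pass_under t s (x a1) b else b = pass_under t s (x a1) (x b2)"
    using colT' unfolding b_def by (auto split: if_splits)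
  \<comment> \<open>seen from the lower strand: the middle color met after the upper strand is the one met before it, passed under with sign \<open>p\<close>\<close>
  have key: "if r then x b2 = pass_under t p (x a1) b else b = pass_under t p (x a1) (x b2)"
  proof (cases "p = s")
    case True
    then have order: "r \<longleftrightarrow> k = u" unfolding r_def by (cases u; cases p) auto
    show ?thesis unfolding order using middle True by (simp only:)
  next
    case False
    then have p: "p = (\<not> s)" by blast
    then have order: "r \<longleftrightarrow> k \<noteq> u" unfolding r_def by (cases s; cases u) auto
    show ?thesis
    proof (cases "k = u")
      case True
      then have "b = pass_under t p (x a1) (x b2)"
        using middle p by (simp add: pass_under_inverse[OF t])
      with True show ?thesis unfolding order by (simp only: simp_thms if_False)
    next
      case False
      then have "x b2 = pass_under t p (x a1) b"
        using middle p by (simp add: pass_under_inverse[OF t])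
      with False show ?thesis unfolding order by (simp only: simp_thms if_True)
    qed
  qed
  have c3: "if r then x c3 = pass_under t p (x a1) c else x c3 = pass_under t u b c"
  proof (cases r)
    case True
    then have "x c3 = pass_under t u (pass_under t p (x a1) b) (pass_under t p (x a1) (x c1))"
      using colT' key by simp
    with True show ?thesis by (simp add: c_def pass_under_distrib[OF t, of p "x a1"])
  next
    case False
    then have "b = pass_under t p (x a1) (x b2)"
      "x c3 = pass_under t p (x a1) (pass_under t u (x b2) (x c1))"
      using colT' key by simp_all
    with False show ?thesis by (simp add: c_def pass_under_distrib[OF t, of p "x a1" u])
  qed
  have strands: "x a2 = x a1" "x a3 = x a1"
      "if k = u then b = x b1 \<and> x b3 = pass_under t s (x a1) (x b1)
       else b = pass_under t s (x a1) (x b1) \<and> x b3 = b"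
    using colT' unfolding b_def by (auto split: if_splits)
  have flip: "((\<not> k) = s) = (p = u) \<longleftrightarrow> \<not> r" "(\<not> k) = u \<longleftrightarrow> k \<noteq> u"
    by (auto simp: r_def)
  have moved: "?x b2 = b" "?x c2 = c" "?x a1 = x a1" "?x a2 = x a2" "?x a3 = x a3" "?x b1 = x b1"
    "?x b3 = x b3" "?x c1 = x c1" "?x c3 = x c3"
    using distinct by auto
  have "coloring t T' ?x"
  proof -
    have "if r then c = pass_under t u b (x c1) \<and> x c3 = pass_under t p (x a1) c
          else c = pass_under t p (x a1) (x c1) \<and> x c3 = pass_under t u b c"
      using c3 by (cases r) (simp_all only: c_def if_True if_False simp_thms)
    with strands show ?thesis
      unfolding T coloring_triangle flip moved
      by (cases r; cases "k = u") (simp_all only: if_True if_False simp_thms)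
  qed
  moreover have "coloring t R ?x"
    using notin colR by simp
  moreover have "\<forall>a\<in>arcs (T + R). x a = k" if "\<forall>a\<in>arcs (T' + R). ?x a = k" for k
  proof -
    have "x a1 = k" "x b1 = k" "x c1 = k" "\<forall>a\<in>#heads R. x a = k"
      using that distinct notin unfolding arcs_def T heads_simps heads_triangle by (auto split: if_splits)
    with colT show ?thesis
      unfolding arcs_def T heads_simps heads_triangle coloring_triangle
      by (auto simp: pass_under_same t split: if_splits)
  qed
  ultimately show ?thesis
    unfolding recolorable_def by (intro exI[of _ ?x]) simp
qed

lemma reidemeister_recolorable:
  assumes "reidemeister L L'" and t: "t \<noteq> 0"
    and D: "well_formed (L + R)" and x: "coloring t (L + R) x"
  shows "recolorable t (L + R) (L' + R) x"
  using assms(1)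
proof (cases rule: reidemeister.cases)
  case (R1_over s a e b)
  show ?thesis using x unfolding R1_over recolorable_def
    by (intro exI[of _ x]) (auto simp: arcs_def pass_under_same t)
next
  case (R1_under s e b a)
  show ?thesis using x unfolding R1_under recolorable_def
    by (intro exI[of _ x]) (auto simp: arcs_def pass_under_eq_over t)
next
  case (R2_parallel s a b p q c r)
  show ?thesis using x unfolding R2_parallel recolorable_def
    by (intro exI[of _ x]) (auto simp: arcs_def pass_under_same pass_under_inverse t)
next
  case (R2_antiparallel s a b q r c p)
  show ?thesis using x unfolding R2_antiparallel recolorable_def
    by (intro exI[of _ x]) (auto simp: arcs_def pass_under_same pass_under_inverse' t)
next
  case (R3 s t' u a1 a2 a3 b1 b2 b3 c1 c2 c3)
  show ?thesis
    by (rule triangle_recolorable[OF t, where k = True, OF R3(1)]) (use R3 well_formed_distinct[OF D] x in simp_all)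
qed

text \<open>
  When a move creates arcs, the colors of the new ones are forced by the strands that they belong to.
\<close>

lemma reidemeister_recolorable_back:
  assumes "reidemeister L L'" and t: "t \<noteq> 0"
    and D: "well_formed (L + R)" and D': "well_formed (L' + R)" and x: "coloring t (L' + R) x"
  shows "recolorable t (L' + R) (L + R) x"
  using assms(1)
proof (cases rule: reidemeister.cases)
  case (R1_over s a e b)
  show ?thesis using x well_formed_distinct[OF D] unfolding R1_over recolorable_def
    by (intro exI[of _ "x(e := x a)"]) (auto simp: arcs_def pass_under_same t)
next
  case (R1_under s e b a)
  show ?thesis using x well_formed_distinct[OF D] unfolding R1_under recolorable_def
    by (intro exI[of _ "x(e := x a)"]) (auto simp: arcs_def pass_under_same t)
next
  case (R2_parallel s a b p q c r)
  show ?thesis using x well_formed_distinct[OF D] unfolding R2_parallel recolorable_def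
    by (intro exI[of _ "x(b := x a, q := pass_under t s (x a) (x p))"])
      (auto simp: arcs_def pass_under_inverse t)
next
  case (R2_antiparallel s a b q r c p)
  show ?thesis using x well_formed_distinct[OF D] unfolding R2_antiparallel recolorable_def
    by (intro exI[of _ "x(b := x a, q := pass_under t (\<not> s) (x a) (x p))"])
      (auto simp: arcs_def pass_under_inverse' t)
next
  case (R3 s t' u a1 a2 a3 b1 b2 b3 c1 c2 c3)
  show ?thesis
    by (rule triangle_recolorable[OF t, where k = False, OF R3(2)]) (use R3 well_formed_distinct[OF D'] x in simp_all)
qed

lemma monochromaticI_recolorable:
  assumes "\<And>x. coloring t D x \<Longrightarrow> recolorable t D D' x" and "monochromatic t D'"
  shows "monochromatic t D"
  unfolding monochromatic_def
proof (intro allI impI)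
  fix x assume "coloring t D x"
  then obtain x' where "coloring t D' x'"
    and "\<And>k. \<forall>a\<in>arcs D'. x' a = k \<Longrightarrow> \<forall>a\<in>arcs D. x a = k"
    using assms(1) unfolding recolorable_def by blast
  with assms(2) show "\<exists>k. \<forall>a\<in>arcs D. x a = k"
    unfolding monochromatic_def by meson
qed

lemma coloring_map_node:
  "coloring t (image_mset (map_node f) D) x \<longleftrightarrow> coloring t D (x \<circ> f)"
proof -
  have "node_rule t x (map_node f N) \<longleftrightarrow> node_rule t (x \<circ> f) N" for N
    by (cases N) auto
  then show ?thesis by (simp add: coloring_def)
qed

lemma arcs_map_node: "arcs (image_mset (map_node f) D) = f ` arcs D"
proof -
  have "arcs_into (map_node f N) = image_mset f (arcs_into N)" for N :: "nat node"
    by (cases N) auto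
  then show ?thesis by (induction D) (auto simp: arcs_def image_Un)
qed

lemma diagram_move_monochromatic:
  assumes "diagram_move D D'" and wf: "well_formed D" "well_formed D'" and t: "t \<noteq> 0"
  shows "monochromatic t D \<longleftrightarrow> monochromatic t D'"
  using assms(1)
proof (cases rule: diagram_move.cases)
  case (reidemeister_move L L' R)
  then show ?thesis
    using reidemeister_recolorable[of L L' t R] reidemeister_recolorable_back[of L L' t R] wf t
    by (metis monochromaticI_recolorable)
next
  case (remove_joint a b R)
  define f where "f = (\<lambda>c. if c = b then a else c)"
  have D: "D = add_mset (Joint a b) R" and D': "D' = image_mset (map_node f) R"
    using remove_joint by (simp_all add: f_def)
  \<comment> \<open>the arc that starts at the joint, now labelled \<open>a\<close>, still ends somewhere in \<open>R\<close>\<close>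
  have "b \<in># heads D"
    using wf(1) by (simp add: D well_formed_def)
  then have "b \<in> arcs R"
    using remove_joint by (auto simp: D arcs_def)
  then have "a \<in> f ` arcs R"
    by (auto simp: f_def intro!: image_eqI[of _ _ b])
  then have arcs: "f ` arcs D = arcs D'"
    unfolding D D' arcs_map_node using \<open>a \<noteq> b\<close> by (auto simp: arcs_def f_def)
  have to_D': "x \<circ> f = x \<and> coloring t D' x" if "coloring t D x" for x :: "nat \<Rightarrow> 'a"
  proof -
    have "x \<circ> f = x" using that by (auto simp: D f_def)
    then show ?thesis using that by (simp add: D D' coloring_map_node)
  qed
  have to_D: "coloring t D (x \<circ> f)" if "coloring t D' x" for x :: "nat \<Rightarrow> 'a"
    using that by (simp add: D D' coloring_map_node) (simp add: f_def)
  show ?thesis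
  proof
    assume mono: "monochromatic t D"
    show "monochromatic t D'" unfolding monochromatic_def
    proof (intro allI impI)
      fix x :: "nat \<Rightarrow> 'a" assume "coloring t D' x"
      then obtain k where "\<forall>a\<in>arcs D. (x \<circ> f) a = k"
        using mono to_D unfolding monochromatic_def by blast
      then show "\<exists>k. \<forall>a\<in>arcs D'. x a = k"
        unfolding arcs[symmetric] by auto
    qed
  next
    assume mono: "monochromatic t D'"
    show "monochromatic t D" unfolding monochromatic_def
    proof (intro allI impI)
      fix x :: "nat \<Rightarrow> 'a" assume "coloring t D x"
      then have "x \<circ> f = x" and "\<exists>k. \<forall>a\<in>f ` arcs D. x a = k"
        using mono to_D' unfolding monochromatic_def arcs by blast+
      then show "\<exists>k. \<forall>a\<in>arcs D. x a = k"
        by (metis comp_apply imageI)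
    qed
  qed
next
  case (relabel f)
  have D': "D' = image_mset (map_node f) D" and f: "inj_on f (arcs D)"
    using relabel by simp_all
  have pulled: "coloring t D' (x \<circ> inv_into (arcs D) f) \<longleftrightarrow> coloring t D x" for x :: "nat \<Rightarrow> 'a"
    unfolding D' coloring_map_node
    by (rule coloring_cong) (use f wf(1) in \<open>auto simp: arcs_def well_formed_def\<close>)
  show ?thesis
  proof
    assume mono: "monochromatic t D"
    show "monochromatic t D'" unfolding monochromatic_def
    proof (intro allI impI)
      fix x :: "nat \<Rightarrow> 'a" assume "coloring t D' x"
      then obtain k where "\<forall>a\<in>arcs D. (x \<circ> f) a = k"
        using mono unfolding D' coloring_map_node monochromatic_def by blast
      then show "\<exists>k. \<forall>a\<in>arcs D'. x a = k"
        unfolding D' arcs_map_node by auto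
    qed
  next
    assume mono: "monochromatic t D'"
    show "monochromatic t D" unfolding monochromatic_def
    proof (intro allI impI)
      fix x :: "nat \<Rightarrow> 'a" assume "coloring t D x"
      then obtain k where "\<forall>a\<in>f ` arcs D. (x \<circ> inv_into (arcs D) f) a = k"
        using mono pulled unfolding monochromatic_def D' arcs_map_node by blast
      then have "\<forall>a\<in>arcs D. x a = k"
        using f by simp
      then show "\<exists>k. \<forall>a\<in>arcs D. x a = k" ..
    qed
  qed
qed

lemma equivclp_invariant:
  assumes "equivclp r x y" and "\<And>x y. r x y \<Longrightarrow> f x = f y"
  shows "f x = f y"
  using assms(1) by (induction rule: equivclp_induct) (auto dest: assms(2))

lemma same_link_monochromatic:
  assumes "same_link D D'" and "t \<noteq> 0"
  shows "monochromatic t D \<longleftrightarrow> monochromatic t D'"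
  using assms(1) unfolding same_link_def
  by (rule equivclp_invariant) (simp add: oriented_diagram_def diagram_move_monochromatic assms(2))

section \<open>Closed braids and the Burau action\<close>

text \<open>
  How the colors of the strands at positions \<open>i\<close> and \<open>i + 1\<close> change from just below a letter to just
  above it.  The strand that moves right is the upper one for a positive letter and the lower one
  for a negative letter.
\<close>

fun braid_letter :: "'k::field \<Rightarrow> nat \<times> bool \<Rightarrow> (nat \<Rightarrow> 'k) \<Rightarrow> nat \<Rightarrow> 'k" where
  "braid_letter t (i, s) v =
    (if s then v(i := pass_under t s (v i) (v (i + 1)), i + 1 := v i)
     else v(i := v (i + 1), i + 1 := pass_under t s (v (i + 1)) (v i)))"

definition burau :: "'k::field \<Rightarrow> braid_word \<Rightarrow> (nat \<Rightarrow> 'k) \<Rightarrow> nat \<Rightarrow> 'k" where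
  "burau t w = fold (braid_letter t) w"

lemma burau_simps [simp]:
  "burau t [] v = v"
  "burau t (e # w) v = burau t w (braid_letter t e v)"
  "burau t (u @ w) v = burau t w (burau t u v)"
  by (simp_all add: burau_def)

text \<open>
  This is the Burau representation.  Since the colorings of a closure correspond to its fixed
  vectors, their existence depends on the braid alone.
\<close>

lemma burau_braid_relation:
  assumes "braid_relation n v w" and "t \<noteq> 0"
  shows "burau t v = burau t w"
  using assms(1)
proof (cases rule: braid_relation.cases)
  case (cancel i u s v')
  have "braid_letter t (i, \<not> s) (braid_letter t (i, s) x) = x" for x
    using pass_under_inverse[OF \<open>t \<noteq> 0\<close>, of True] pass_under_inverse[OF \<open>t \<noteq> 0\<close>, of False]
    by (cases s) (auto simp: fun_eq_iff)
  then show ?thesis by (intro ext) (simp add: cancel del: braid_letter.simps)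
next
  case (commute i j u v')
  have "braid_letter t (j, True) (braid_letter t (i, True) x) = braid_letter t (i, True) (braid_letter t (j, True) x)" for x
    using commute by (auto simp: fun_eq_iff)
  then show ?thesis by (intro ext) (simp add: commute del: braid_letter.simps)
next
  case (braid i u v')
  have "braid_letter t (i, True) (braid_letter t (i + 1, True) (braid_letter t (i, True) x)) =
      braid_letter t (i + 1, True) (braid_letter t (i, True) (braid_letter t (i + 1, True) x))" for x
    using pass_under_distrib[OF \<open>t \<noteq> 0\<close>, of True "x i" True "x (i + 1)" "x (i + 2)"]
    by (auto simp: fun_eq_iff)
  then show ?thesis by (intro ext) (simp add: braid del: braid_letter.simps)
qed

lemma coloring_sum_mset: "coloring t (\<Sum>l\<in>#M. f l) x \<longleftrightarrow> (\<forall>l\<in>#M. coloring t (f l) x)"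
  by (induction M) auto

lemma arcs_simps:
  "arcs {#} = {}" "arcs (add_mset N D) = set_mset (arcs_into N) \<union> arcs D"
  "arcs (D + D') = arcs D \<union> arcs D'" "arcs (\<Sum>l\<in>#M. f l) = (\<Union>l\<in>set_mset M. arcs (f l))"
  "arcs {#Joint (g p) (h p). p \<in># L#} = g ` set_mset L"
proof -
  show "arcs (\<Sum>l\<in>#M. f l) = (\<Union>l\<in>set_mset M. arcs (f l))" by (induction M) (auto simp: arcs_def)
  show "arcs {#Joint (g p) (h p). p \<in># L#} = g ` set_mset L" by (induction L) (auto simp: arcs_def)
qed (auto simp: arcs_def)

lemma strands_split:
  fixes i n :: nat
  assumes "1 \<le> i" "i < n"
  shows "{1..n} = insert i (insert (i + 1) ({1..n} - {i, i + 1}))"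
  using assms by auto

lemma coloring_braid_layer:
  assumes "1 \<le> i" "i < n"
  shows "coloring t (braid_layer n l (i, s)) x \<longleftrightarrow>
    (\<forall>p\<in>{1..n}. x ((l + 1) * n + p) = braid_letter t (i, s) (\<lambda>p. x (l * n + p)) p)"
  by (subst strands_split[OF assms]) (auto simp: coloring_def Let_def)

lemma arcs_braid_layer:
  assumes "1 \<le> i" "i < n"
  shows "arcs (braid_layer n l (i, s)) = (\<lambda>p. l * n + p) ` {1..n}"
  by (subst strands_split[OF assms]) (auto simp: arcs_simps Let_def)

lemma braid_words_nth:
  assumes "w \<in> braid_words n" "l < length w"
  obtains i s where "w ! l = (i, s)" "1 \<le> i" "i < n"
  using assms nth_mem[of l w] unfolding braid_words_def by (cases "w ! l") auto

text \<open>
  A coloring of the closure is a vector of colors for each level, where every letter acts by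
  \<open>braid_letter\<close> and the top level equals the bottom level.
\<close>

lemma coloring_closure_diagram:
  assumes "w \<in> braid_words n"
  shows "coloring t (closure_diagram n w) x \<longleftrightarrow>
    (\<forall>l<length w. \<forall>p\<in>{1..n}. x ((l + 1) * n + p) = braid_letter t (w ! l) (\<lambda>p. x (l * n + p)) p) \<and>
    (\<forall>p\<in>{1..n}. x p = x (length w * n + p))"
proof -
  have "coloring t (braid_layer n l (w ! l)) x \<longleftrightarrow>
      (\<forall>p\<in>{1..n}. x ((l + 1) * n + p) = braid_letter t (w ! l) (\<lambda>p. x (l * n + p)) p)" if "l < length w" for l
    using braid_words_nth[OF assms that] coloring_braid_layer by metis
  then show ?thesis
    unfolding closure_diagram_def coloring_plus coloring_sum_mset
    by (auto simp: coloring_def)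
qed

lemma arcs_closure_diagram:
  assumes "w \<in> braid_words n"
  shows "arcs (closure_diagram n w) = (\<Union>l\<le>length w. (\<lambda>p. l * n + p) ` {1..n})"
proof -
  have "arcs (braid_layer n l (w ! l)) = (\<lambda>p. l * n + p) ` {1..n}" if "l < length w" for l
    using braid_words_nth[OF assms that] arcs_braid_layer by metis
  then have "arcs (closure_diagram n w) =
      (\<Union>l\<in>{..<length w}. (\<lambda>p. l * n + p) ` {1..n}) \<union> (\<lambda>p. length w * n + p) ` {1..n}"
    unfolding closure_diagram_def arcs_simps by simp
  also have "\<dots> = (\<Union>l\<in>insert (length w) {..<length w}. (\<lambda>p. l * n + p) ` {1..n})"
    by (simp only: UN_insert Un_commute)
  also have "insert (length w) {..<length w} = {..length w}"
    by auto
  finally show ?thesis .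
qed

lemma braid_letter_cong:
  assumes "1 \<le> fst e" "fst e < n" "\<And>p. p \<in> {1..n} \<Longrightarrow> u p = v p" "p \<in> {1..n}"
  shows "braid_letter t e u p = braid_letter t e v p"
  using assms by (cases e) auto

lemma burau_take_Suc:
  "l < length w \<Longrightarrow> burau t (take (Suc l) w) v = braid_letter t (w ! l) (burau t (take l w) v)"
  by (simp add: take_Suc_conv_app_nth del: braid_letter.simps)

lemma coloring_closure_burau:
  assumes w: "w \<in> braid_words n" and x: "coloring t (closure_diagram n w) x"
    and "l \<le> length w" "p \<in> {1..n}"
  shows "x (l * n + p) = burau t (take l w) x p"
  using assms(3,4)
proof (induction l arbitrary: p)
  case 0
  then show ?case by simp
next
  case (Suc l)
  then have l: "l < length w" by simp
  obtain i s where e: "w ! l = (i, s)" "1 \<le> i" "i < n"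
    using braid_words_nth[OF w l] .
  have "x ((l + 1) * n + p) = braid_letter t (w ! l) (\<lambda>p. x (l * n + p)) p"
    using x l Suc.prems unfolding coloring_closure_diagram[OF w] by blast
  also have "\<dots> = braid_letter t (w ! l) (burau t (take l w) x) p"
    by (rule braid_letter_cong[where n = n]) (use e Suc in auto)
  finally show ?case
    using l by (simp add: burau_take_Suc del: braid_letter.simps)
qed

lemma burau_constant:
  assumes "w \<in> braid_words n" "t \<noteq> 0" "\<forall>p\<in>{1..n}. v p = k"
  shows "\<forall>p\<in>{1..n}. burau t w v p = k"
  using assms(1,3)
proof (induction w arbitrary: v)
  case (Cons e w)
  obtain i s where e: "e = (i, s)" "1 \<le> i" "i < n"
    using Cons.prems by (cases e) (auto simp: braid_words_def)
  have "\<forall>p\<in>{1..n}. braid_letter t e v p = k"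
    using Cons.prems(2) e by (auto simp: pass_under_same[OF assms(2)])
  moreover have "w \<in> braid_words n"
    using Cons.prems by (auto simp: braid_words_def)
  ultimately show ?case
    using Cons.IH by (simp del: braid_letter.simps)
qed simp

text \<open>
  The bottom level determines the whole coloring, and a bottom level extends to a coloring iff
  the Burau action returns it unchanged at the top.
\<close>

lemma monochromatic_closure_iff:
  assumes w: "w \<in> braid_words n" and t: "t \<noteq> 0"
  shows "monochromatic t (closure_diagram n w) \<longleftrightarrow>
    (\<forall>v. (\<forall>p\<in>{1..n}. burau t w v p = v p) \<longrightarrow> (\<exists>k. \<forall>p\<in>{1..n}. v p = k))"
proof (intro iffI allI impI)
  fix v
  assume mono: "monochromatic t (closure_diagram n w)"
    and fixed: "\<forall>p\<in>{1..n}. burau t w v p = v p"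
  \<comment> \<open>decodes the label \<open>l * n + p\<close>; positions start at one, hence the shift\<close>
  define x where "x a = burau t (take ((a - 1) div n) w) v ((a - 1) mod n + 1)" for a
  have level: "x (l * n + p) = burau t (take l w) v p" if "p \<in> {1..n}" for l p
  proof -
    obtain q where q: "p = q + 1" "q < n" using \<open>p \<in> {1..n}\<close> by (cases p) auto
    have "l * n + p - 1 = q + l * n" using q by simp
    with q show ?thesis by (simp add: x_def)
  qed
  have "coloring t (closure_diagram n w) x"
    unfolding coloring_closure_diagram[OF w]
  proof (intro conjI allI impI ballI)
    fix l p assume l: "l < length w" and p: "p \<in> {1..n}"
    obtain i s where e: "w ! l = (i, s)" "1 \<le> i" "i < n"
      using braid_words_nth[OF w l] .
    have "braid_letter t (w ! l) (\<lambda>p. x (l * n + p)) p = braid_letter t (w ! l) (burau t (take l w) v) p"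
      by (rule braid_letter_cong[where n = n]) (use e p level in auto)
    then show "x ((l + 1) * n + p) = braid_letter t (w ! l) (\<lambda>p. x (l * n + p)) p"
      using level[OF p, of "l + 1"] l by (simp add: burau_take_Suc del: braid_letter.simps)
  next
    fix p assume p: "p \<in> {1..n}"
    show "x p = x (length w * n + p)"
      using level[OF p, of 0] level[OF p, of "length w"] fixed p by simp
  qed
  then obtain k where k: "\<forall>a\<in>arcs (closure_diagram n w). x a = k"
    using mono unfolding monochromatic_def by blast
  have "v p = k" if p: "p \<in> {1..n}" for p
  proof -
    have "0 * n + p \<in> arcs (closure_diagram n w)"
      unfolding arcs_closure_diagram[OF w] using p by blast
    then show ?thesis using k level[OF p, of 0] by simp
  qed
  then show "\<exists>k. \<forall>p\<in>{1..n}. v p = k" by blast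
next
  assume *: "\<forall>v. (\<forall>p\<in>{1..n}. burau t w v p = v p) \<longrightarrow> (\<exists>k. \<forall>p\<in>{1..n}. v p = k)"
  show "monochromatic t (closure_diagram n w)"
    unfolding monochromatic_def
  proof (intro allI impI)
    fix x assume x: "coloring t (closure_diagram n w) x"
    note level = coloring_closure_burau[OF w x]
    have "burau t w x p = x p" if p: "p \<in> {1..n}" for p
      using level[of "length w" p] x p unfolding coloring_closure_diagram[OF w] by simp
    then obtain k where k: "\<forall>p\<in>{1..n}. x p = k"
      using * by blast
    have "x (l * n + p) = k" if "l \<le> length w" "p \<in> {1..n}" for l p
    proof -
      have "take l w \<in> braid_words n"
        using w by (auto simp: braid_words_def dest: in_set_takeD)
      then show ?thesis using burau_constant[OF _ t k] level[OF that] that by simp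
    qed
    then show "\<exists>k. \<forall>a\<in>arcs (closure_diagram n w). x a = k"
      unfolding arcs_closure_diagram[OF w] by blast
  qed
qed

section \<open>Homogeneous words with all generators\<close>

text \<open>
  Divisibility of a Laurent series by \<open>t\<^sup>k\<close>.  Stated by coefficients it needs no exception for
  the zero series, whose subdegree is zero by convention.
\<close>

definition order_ge :: "int \<Rightarrow> 'k::field fls \<Rightarrow> bool" where
  "order_ge k f \<longleftrightarrow> (\<forall>j<k. fls_nth f j = 0)"

lemma order_ge_simps:
  "order_ge k f \<Longrightarrow> order_ge k g \<Longrightarrow> order_ge k (f + g)"
  "order_ge k f \<Longrightarrow> order_ge k (- f)"
  "order_ge k f \<Longrightarrow> order_ge (k + 1) (fls_X * f)"
  by (auto simp: order_ge_def fls_X_times_conv_shift)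

lemma order_ge_mono: "order_ge k f \<Longrightarrow> j \<le> k \<Longrightarrow> order_ge j f"
  by (auto simp: order_ge_def)

lemma order_ge_all: "(\<And>m::nat. order_ge (k + int m) f) \<Longrightarrow> f = 0"
proof (rule fls_eqI)
  fix j assume "\<And>m::nat. order_ge (k + int m) f"
  then have "order_ge (k + int (nat (j - k + 1))) f" .
  then show "fls_nth f j = fls_nth 0 j" by (simp add: order_ge_def)
qed

lemma finite_order_ge: "finite S \<Longrightarrow> \<exists>k. \<forall>f\<in>S. order_ge k f"
proof (induction S rule: finite_induct)
  case (insert f S)
  then obtain k where "\<forall>f\<in>S. order_ge k f" by blast
  moreover have "order_ge (fls_subdegree f) f" by (simp add: order_ge_def)
  ultimately have "\<forall>g\<in>insert f S. order_ge (min k (fls_subdegree f)) g"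
    by (auto intro: order_ge_mono)
  then show ?case by blast
qed simp

text \<open>
  On a circle of levels, where the top level \<open>N\<close> is identified with the level \<open>0\<close>, a property that
  is passed on in one direction and holds somewhere holds everywhere.
\<close>

lemma cyclic_forward:
  fixes P :: "nat \<Rightarrow> bool"
  assumes step: "\<And>l. l < N \<Longrightarrow> P l \<Longrightarrow> P (Suc l)" and "P N \<Longrightarrow> P 0"
    and "l0 \<le> N" "P l0" "l \<le> N"
  shows "P l"
proof -
  have up: "P j" if "P i" "i \<le> j" "j \<le> N" for i j
    using that(2,1,3) by (induction rule: dec_induct) (auto intro: step)
  then show ?thesis using assms up[of l0 N] up[of 0 l] by simp
qed

lemma cyclic_backward:
  fixes P :: "nat \<Rightarrow> bool"
  assumes step: "\<And>l. l < N \<Longrightarrow> P (Suc l) \<Longrightarrow> P l" and "P 0 \<Longrightarrow> P N"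
    and "l0 \<le> N" "P l0" "l \<le> N"
  shows "P l"
  using cyclic_forward[of N "\<lambda>l. P (N - l)" "N - l0" "N - l"] assms
  by (simp add: Suc_diff_Suc)

definition jump :: "(nat \<Rightarrow> 'k::field) \<Rightarrow> nat \<Rightarrow> 'k" where
  "jump v i = v (i + 1) - v i"

text \<open>
  At a letter of column \<open>j\<close> the difference of the two crossing strands is multiplied by \<open>- t\<close>, upwards
  for a positive and downwards for a negative letter.  Up to sign, \<open>U\<close> is the value without the
  factor \<open>t\<close>.  Measured by it, a letter of either sign affects the neighbouring columns in the same way:
  the column to the right receives \<open>U\<close>, the one to the left only \<open>t U\<close>.
\<close>

lemma jump_braid_letter:
  assumes "t \<noteq> 0" and v': "v' = braid_letter t (j, s) v"
    and U: "U = (if s then jump v j else - jump v' j)"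
  shows "if s then jump v' j = - (t * jump v j) else jump v j = - (t * jump v' j)"
    and "i = j + 1 \<Longrightarrow> jump v' i = jump v i + U"
    and "i + 1 = j \<Longrightarrow> jump v' i = jump v i + t * U"
    and "i \<noteq> j \<Longrightarrow> i \<noteq> j + 1 \<Longrightarrow> i + 1 \<noteq> j \<Longrightarrow> jump v' i = jump v i"
  using \<open>t \<noteq> 0\<close> unfolding U v'
  by (cases s; force simp: jump_def pass_under_def field_simps)+

text \<open>
  If all jumps are divisible by \<open>t\<^sup>k\<close>, then they are divisible by \<open>t\<^sup>k\<^sup>+\<^sup>1\<close>, by induction on the column
  from left to right.  Modulo \<open>t\<^sup>k\<^sup>+\<^sup>1\<close> the jump of a column is not affected by letters of other
  columns: those on the right contribute a multiple of \<open>t U\<close>, and those on the left contribute a \<open>U\<close>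
  that is divisible by the induction hypothesis.  A positive letter of the column itself makes the
  jump divisible above it, a negative letter below it.  As the word is homogeneous, all letters of the
  column push the divisibility in the same direction around the closed braid, and as the word is full,
  there is one that starts it.  Hence all jumps vanish.
\<close>

lemma full_homogeneous_fixed_constant:
  fixes v :: "nat \<Rightarrow> 'k::field fls"
  assumes w: "w \<in> braid_words n" "homogeneous_word w"
    and full: "\<And>i. 1 \<le> i \<Longrightarrow> i < n \<Longrightarrow> \<exists>s. (i, s) \<in> set w"
    and fixed: "\<forall>p\<in>{1..n}. burau fls_X w v p = v p"
    and "p \<in> {1..n}"
  shows "v p = v 1"
proof -
  define N where "N = length w"
  define Y where "Y l = jump (burau fls_X (take l w) v)" for l
  have Y_cyclic: "Y N i = Y 0 i" if "1 \<le> i" "i < n" for i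
    using fixed that by (simp add: Y_def N_def jump_def)
  have letter_step: "burau fls_X (take (Suc l) w) v = braid_letter fls_X (w ! l) (burau fls_X (take l w) v)"
    if "l < N" for l
    using that by (simp add: N_def take_Suc_conv_app_nth del: braid_letter.simps)
  have letter: "\<exists>j s. w ! l = (j, s) \<and> 1 \<le> j \<and> j < n" if "l < N" for l
    using w(1) nth_mem[of l w] that unfolding braid_words_def N_def by (cases "w ! l") auto
  have improve: "order_ge (k + 1) (Y l i)"
    if k: "\<And>l i. l \<le> N \<Longrightarrow> 1 \<le> i \<Longrightarrow> i < n \<Longrightarrow> order_ge k (Y l i)"
      and "l \<le> N" "1 \<le> i" "i < n" for k l i
    using that(2-4)
  proof (induction i arbitrary: l rule: less_induct)
    case (less i)
    \<comment> \<open>letters of other columns do not affect the jump modulo the next power\<close>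
    have other: "order_ge (k + 1) (Y (Suc l) i - Y l i)"
      if l: "l < N" and e: "w ! l = (j, s)" and "j \<noteq> i" for l j s
    proof -
      define U where "U = (if s then Y l j else - Y (Suc l) j)"
      have j: "1 \<le> j" "j < n" using letter[OF l] e by auto
      note jump = jump_braid_letter[OF fls_X_nonzero letter_step[OF l, unfolded e] U_def[unfolded Y_def], folded Y_def]
      have U: "order_ge k U"
        unfolding U_def using k[OF _ j, of l] k[OF _ j, of "Suc l"] l by (simp add: order_ge_simps)
      consider "i = j + 1" | "i + 1 = j" | "i \<noteq> j + 1" "i + 1 \<noteq> j" by blast
      then show ?thesis
      proof cases
        case 1
        then have "order_ge (k + 1) U"
          unfolding U_def using less.IH[of j l] less.IH[of j "Suc l"] j l less.prems
          by (simp add: order_ge_simps)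
        then show ?thesis using jump(2)[OF 1] by simp
      next
        case 2
        then show ?thesis using jump(3)[OF 2] order_ge_simps(3)[OF U] by simp
      next
        case 3
        then show ?thesis using jump(4) \<open>j \<noteq> i\<close> by (simp add: order_ge_def)
      qed
    qed
    obtain s where s: "(i, s) \<in> set w" using full less.prems by blast
    then obtain l0 where l0: "l0 < N" "w ! l0 = (i, s)" by (auto simp: in_set_conv_nth N_def)
    have sign: "s' = s" if "l < N" "w ! l = (i, s')" for l s'
      using w(2) s nth_mem[of l w] that unfolding homogeneous_word_def N_def by metis
    have same: "if s then order_ge (k + 1) (Y (Suc l) i) else order_ge (k + 1) (Y l i)"
      if l: "l < N" and e: "w ! l = (i, s)" for l
    proof -
      have "order_ge k (Y l i)" "order_ge k (Y (Suc l) i)"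
        using k l less.prems by simp_all
      moreover have "if s then Y (Suc l) i = - (fls_X * Y l i) else Y l i = - (fls_X * Y (Suc l) i)"
        using jump_braid_letter(1)[OF fls_X_nonzero letter_step[OF l, unfolded e] refl] by (simp only: Y_def)
      ultimately show ?thesis by (cases s) (simp_all add: order_ge_simps)
    qed
    let ?P = "\<lambda>l. order_ge (k + 1) (Y l i)"
    show ?case
    proof (cases s)
      case True
      have "?P (Suc l)" if l: "l < N" "?P l" for l
      proof (cases "fst (w ! l) = i")
        case eq: True
        then show ?thesis using same[OF l(1)] sign[OF l(1)] True by (cases "w ! l") auto
      next
        case False
        then have "order_ge (k + 1) (Y (Suc l) i - Y l i)"
          using other[OF l(1)] by (cases "w ! l") auto
        from order_ge_simps(1)[OF this l(2)] show ?thesis by simp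
      qed
      moreover have "?P (Suc l0)" using same[OF l0] True by simp
      ultimately show ?thesis
        using cyclic_forward[of N ?P "Suc l0" l] l0(1) less.prems Y_cyclic by simp
    next
      case False
      have "?P l" if l: "l < N" "?P (Suc l)" for l
      proof (cases "fst (w ! l) = i")
        case eq: True
        then show ?thesis using same[OF l(1)] sign[OF l(1)] False by (cases "w ! l") auto
      next
        case False
        then have "order_ge (k + 1) (Y (Suc l) i - Y l i)"
          using other[OF l(1)] by (cases "w ! l") auto
        from order_ge_simps(1)[OF order_ge_simps(2)[OF this] l(2)] show ?thesis by simp
      qed
      moreover have "?P l0" using same[OF l0] False by simp
      ultimately show ?thesis
        using cyclic_backward[of N ?P l0 l] l0(1) less.prems Y_cyclic by simp
    qed
  qed
  have "finite ((\<lambda>(l, i). Y l i) ` ({..N} \<times> {1..<n}))" by simp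
  from finite_order_ge[OF this] obtain k
    where k: "\<And>l i. l \<le> N \<Longrightarrow> 1 \<le> i \<Longrightarrow> i < n \<Longrightarrow> order_ge k (Y l i)"
    by fastforce
  have "order_ge (k + int m) (Y l i)" if "l \<le> N" "1 \<le> i" "i < n" for m l i
    using that
  proof (induction m arbitrary: l i)
    case 0
    then show ?case using k by simp
  next
    case (Suc m)
    then show ?case using improve[of "k + int m" l i] by (simp add: ac_simps)
  qed
  then have "Y 0 i = 0" if "1 \<le> i" "i < n" for i
    using order_ge_all that by blast
  then have step: "v (Suc i) = v i" if "1 \<le> i" "i < n" for i
    using that by (simp add: Y_def jump_def)
  have "1 \<le> p" "p \<le> n" using \<open>p \<in> {1..n}\<close> by auto
  then show ?thesis
    by (induction p rule: dec_induct) (simp_all add: step)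
qed

text \<open>
  Without the generator \<open>i\<close> no strand passes between the positions up to \<open>i\<close> and those above \<open>i\<close>, so
  two blocks of constant colors persist.
\<close>

lemma burau_missing_generator:
  assumes "t \<noteq> 0" "\<forall>s. (i, s) \<notin> set w"
  shows "burau t w (\<lambda>p. if p \<le> i then 0 else 1) = (\<lambda>p. if p \<le> i then 0 else 1)"
  using assms(2)
proof (induction w)
  case (Cons e w)
  obtain j s where e: "e = (j, s)" "j \<noteq> i"
    using Cons.prems by (cases e) auto
  have "braid_letter t e (\<lambda>p. if p \<le> i then 0 else 1) = (\<lambda>p. if p \<le> i then 0 else 1)"
    using e(2) unfolding e(1) by (cases s) (auto simp: fun_eq_iff pass_under_same[OF assms(1)])
  then show ?case using Cons by (simp del: braid_letter.simps)
qed simp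

section \<open>The twisted annulus\<close>

text \<open>
  The classes of a generated equivalence can be counted by means of canonical representatives: \<open>f\<close>
  does not change along \<open>r\<close>, and every element is linked to its own image.
\<close>

lemma card_classes:
  assumes "r \<subseteq> A \<times> A"
    and "\<And>x y. (x, y) \<in> r \<Longrightarrow> f x = f y"
    and rep: "\<And>x. x \<in> A \<Longrightarrow> (x, f x) \<in> (r \<union> r\<inverse>)\<^sup>*"
  shows "card (classes A r) = card (f ` A)"
proof -
  let ?C = "(r \<union> r\<inverse>)\<^sup>*"
  have invariant: "f x = f y" if "(x, y) \<in> ?C" for x y
    using that by induction (use assms(2) in auto)
  have sym: "(y, x) \<in> ?C" if "(x, y) \<in> ?C" for x y
    using that by (metis converse_Un converse_converse rtrancl_converseD sup_commute)
  have connected: "(x, y) \<in> ?C" if "x \<in> A" "y \<in> A" "f x = f y" for x y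
    using rtrancl_trans[OF rep[OF that(1)]] sym[OF rep[OF that(2)]] that(3) by metis
  have fibres: "?C \<inter> A \<times> A = {(x, y). x \<in> A \<and> y \<in> A \<and> f x = f y}"
    using invariant connected by blast
  have "classes A r = (\<lambda>x. {(x, y). x \<in> A \<and> y \<in> A \<and> f x = f y} `` {x}) ` A"
    unfolding classes_def quotient_def fibres by blast
  also have "\<dots> = (\<lambda>z. {y \<in> A. f y = z}) ` f ` A"
    unfolding image_image by (rule image_cong) auto
  finally have "classes A r = (\<lambda>z. {y \<in> A. f y = z}) ` f ` A" .
  moreover have "inj_on (\<lambda>z. {y \<in> A. f y = z}) (f ` A)"
    by (rule inj_onI) blast
  ultimately show ?thesis by (simp add: card_image)
qed

text \<open>
  One strand runs through the arcs \<open>0, 1, 2, 3\<close> and the other, in the opposite direction, through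
  \<open>4, 7, 6, 5\<close>.  Each strand is alternately over and under.  Between consecutive crossings the two
  strands bound a bigon; with a quadrilateral on each side of the band this makes six faces.
\<close>

definition twisted_annulus :: diagram where
  "twisted_annulus = {# Crossing True 0 1 5 4, Crossing True 6 5 1 2,
                        Crossing True 2 3 7 6, Crossing True 4 7 3 0 #}"

text \<open>
  Without the quantified arc ends, rewriting can evaluate \<open>face_step\<close> on a concrete diagram.
\<close>

lemma face_step_eq_image:
  "face_step D = (\<Union>x\<in>set_mset D.
    (\<lambda>i. (apsnd Not (rim x ! i), rim x ! (Suc i mod length (rim x)))) ` {..<length (rim x)})"
proof (intro equalityI subsetI)
  fix e assume "e \<in> face_step D"
  then obtain a h x i where "e = ((a, h), rim x ! (Suc i mod length (rim x)))" "x \<in># D"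
    "i < length (rim x)" "rim x ! i = (a, \<not> h)"
    unfolding face_step_def by blast
  then show "e \<in> (\<Union>x\<in>set_mset D.
    (\<lambda>i. (apsnd Not (rim x ! i), rim x ! (Suc i mod length (rim x)))) ` {..<length (rim x)})"
    by (intro UN_I[of x] image_eqI[of _ _ i]) simp_all
next
  fix e assume "e \<in> (\<Union>x\<in>set_mset D.
    (\<lambda>i. (apsnd Not (rim x ! i), rim x ! (Suc i mod length (rim x)))) ` {..<length (rim x)})"
  then obtain x i where x: "x \<in># D" "i < length (rim x)"
    and e: "e = (apsnd Not (rim x ! i), rim x ! (Suc i mod length (rim x)))"
    by blast
  obtain a h where "rim x ! i = (a, h)" by fastforce
  with x e show "e \<in> face_step D"
    unfolding face_step_def by (intro CollectI exI[of _ a] exI[of _ "\<not> h"] exI[of _ x] exI[of _ i]) simp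
qed

lemma arcs_twisted_annulus: "arcs twisted_annulus = {0, 1, 2, 3, 4, 5, 6, 7}"
  unfolding twisted_annulus_def arcs_def heads_simps arcs_into.simps by simp blast

text \<open>
  A chosen representative of each of the six faces.
\<close>

definition face_corner :: "nat \<times> bool \<Rightarrow> nat \<times> bool" where
  "face_corner x =
    (if x \<in> {(0, False), (5, True), (2, False), (7, True)} then (0, False)
     else if x \<in> {(5, False), (1, False)} then (5, False)
     else if x \<in> {(1, True), (4, False), (3, True), (6, False)} then (1, True)
     else if x \<in> {(4, True), (0, True)} then (4, True)
     else if x \<in> {(2, True), (6, True)} then (2, True)
     else (7, False))"

lemma corner_steps:
  "(\<lambda>i. (apsnd Not (rim (Crossing True a b c d) ! i),
      rim (Crossing True a b c d) ! (Suc i mod length (rim (Crossing True a b c d)))))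
      ` {..<length (rim (Crossing True a b c d))} =
    {((a, False), (c, True)), ((c, False), (b, False)), ((b, True), (d, False)), ((d, True), (a, True))}"
proof -
  have four: "length (rim (Crossing True a b c d)) = 4" by simp
  have corners: "{..<4} = {0, 1, 2, 3::nat}" by auto
  show ?thesis unfolding four corners image_insert image_empty by simp
qed

lemma face_step_twisted_annulus:
  "face_step twisted_annulus =
    {((0, False), (5, True)), ((5, False), (1, False)), ((1, True), (4, False)), ((4, True), (0, True)),
     ((6, False), (1, True)), ((1, False), (5, False)), ((5, True), (2, False)), ((2, True), (6, True)),
     ((2, False), (7, True)), ((7, False), (3, False)), ((3, True), (6, False)), ((6, True), (2, True)),
     ((4, False), (3, True)), ((3, False), (7, False)), ((7, True), (0, False)), ((0, True), (4, True))}"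
  unfolding face_step_eq_image twisted_annulus_def set_mset_add_mset_insert set_mset_empty
    UN_insert UN_empty corner_steps
  by (simp only: Un_insert_left Un_empty_left)

lemma card_faces_twisted_annulus: "card (faces twisted_annulus) = 6"
proof -
  let ?A = "arcs twisted_annulus \<times> (UNIV :: bool set)"
  let ?r = "face_step twisted_annulus"
  have "card (faces twisted_annulus) = card (face_corner ` ?A)"
    unfolding faces_def
  proof (rule card_classes)
    show "?r \<subseteq> ?A \<times> ?A"
      unfolding face_step_twisted_annulus arcs_twisted_annulus by simp
    have "\<forall>e\<in>?r. face_corner (fst e) = face_corner (snd e)"
      unfolding face_step_twisted_annulus by (simp add: face_corner_def)
    then show "face_corner x = face_corner y" if "(x, y) \<in> ?r" for x y
      using that by fastforce
    fix x assume "x \<in> ?A"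
    have step: "(x, z) \<in> (?r \<union> ?r\<inverse>)\<^sup>*" if "(x, z) \<in> ?r \<or> (z, x) \<in> ?r" for x z
      by (rule r_into_rtrancl) (use that in \<open>simp only: Un_iff converse_iff\<close>)
    have two_steps: "(x, z) \<in> (?r \<union> ?r\<inverse>)\<^sup>*" if "(x, y) \<in> ?r" "(y, z) \<in> ?r" for x y z
      using that by (meson UnI1 converse_rtrancl_into_rtrancl r_into_rtrancl)
    \<comment> \<open>the corners opposite to the representatives of the two quadrilaterals; all others are adjacent to theirs\<close>
    have far: "((2, False), (0, False)) \<in> (?r \<union> ?r\<inverse>)\<^sup>*" "((3, True), (1, True)) \<in> (?r \<union> ?r\<inverse>)\<^sup>*"
      by (rule two_steps[of _ "(7, True)"] two_steps[of _ "(6, False)"]; simp add: face_step_twisted_annulus)+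
    have "\<forall>x\<in>?A. x = (2, False) \<or> x = (3, True) \<or> face_corner x = x \<or>
        (x, face_corner x) \<in> ?r \<or> (face_corner x, x) \<in> ?r"
      by (simp add: arcs_twisted_annulus face_step_twisted_annulus face_corner_def
          Times_insert_left UNIV_bool)
    then consider "x = (2, False)" | "x = (3, True)" | "face_corner x = x" |
        "(x, face_corner x) \<in> ?r \<or> (face_corner x, x) \<in> ?r"
      using \<open>x \<in> ?A\<close> by blast
    then show "(x, face_corner x) \<in> (?r \<union> ?r\<inverse>)\<^sup>*"
    proof cases
      case 1
      then show ?thesis using far by (simp add: face_corner_def)
    next
      case 2
      then show ?thesis using far by (simp add: face_corner_def)
    next
      case 4
      then show ?thesis by (rule step)
    qed simp
  qed
  also have "face_corner ` ?A = {(0, False), (5, False), (1, True), (4, True), (2, True), (7, False)}"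
    by (simp add: arcs_twisted_annulus Times_insert_left UNIV_bool face_corner_def insert_commute)
  finally show ?thesis by simp
qed

lemma in_meets_iff:
  "(a, b) \<in> meets D \<longleftrightarrow>
    (\<exists>x\<in>#D. a \<in># arcs_into x + arcs_out_of x \<and> b \<in># arcs_into x + arcs_out_of x)"
  by (simp add: meets_def Bex_def)

lemma meets_subset:
  assumes "well_formed D"
  shows "meets D \<subseteq> arcs D \<times> arcs D"
proof -
  have "a \<in> arcs D" if "x \<in># D" "a \<in># arcs_into x + arcs_out_of x" for a x
  proof -
    have "a \<in># heads D \<or> a \<in># tails D"
      using that by (auto simp: heads_def tails_def)
    then show ?thesis using assms by (simp add: well_formed_def arcs_def)
  qed
  then show ?thesis by (auto simp: in_meets_iff)
qed

lemma well_formed_twisted_annulus: "well_formed twisted_annulus"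
proof -
  have "multiplicity_free (heads twisted_annulus)"
    by (simp add: twisted_annulus_def)
  moreover have "heads twisted_annulus = tails twisted_annulus"
    by (simp add: twisted_annulus_def add_mset_commute)
  ultimately show ?thesis by (simp add: well_formed_def multiplicity_free_def)
qed

lemma card_components_twisted_annulus: "card (diagram_components twisted_annulus) = 1"
proof -
  let ?r = "meets twisted_annulus"
  have "card (diagram_components twisted_annulus) = card ((\<lambda>_. 0::nat) ` arcs twisted_annulus)"
    unfolding diagram_components_def
  proof (rule card_classes)
    show "?r \<subseteq> arcs twisted_annulus \<times> arcs twisted_annulus"
      by (rule meets_subset[OF well_formed_twisted_annulus])
    \<comment> \<open>the crossings at the two ends of the arc \<open>0\<close> meet all arcs but \<open>2\<close> and \<open>6\<close>\<close>
    have hub: "\<forall>a\<in>{0, 1, 3, 4, 5, 7}. (a, 0) \<in> ?r" and spokes: "\<forall>a\<in>{2, 6}. (a, 1) \<in> ?r"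
      by (simp_all add: in_meets_iff twisted_annulus_def)
    fix a assume "a \<in> arcs twisted_annulus"
    then consider "a \<in> {0, 1, 3, 4, 5, 7}" | "a \<in> {2, 6}"
      unfolding arcs_twisted_annulus by blast
    then show "(a, 0) \<in> (?r \<union> ?r\<inverse>)\<^sup>*"
    proof cases
      case 1
      then have "(a, 0) \<in> ?r" using hub by blast
      then show ?thesis by (intro r_into_rtrancl UnI1)
    next
      case 2
      then have "(a, 1) \<in> ?r" "(1, 0) \<in> ?r" using hub spokes by blast+
      then show ?thesis by (meson UnI1 converse_rtrancl_into_rtrancl r_into_rtrancl)
    qed
  qed simp
  also have "\<dots> = 1" by (simp add: arcs_twisted_annulus)
  finally show ?thesis .
qed

lemma oriented_twisted_annulus: "oriented_diagram twisted_annulus"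
proof -
  have "planar twisted_annulus"
    unfolding planar_def card_faces_twisted_annulus card_components_twisted_annulus
    unfolding arcs_twisted_annulus by (simp add: twisted_annulus_def)
  then show ?thesis
    using well_formed_twisted_annulus by (simp add: oriented_diagram_def twisted_annulus_def)
qed

text \<open>
  A diagram whose crossings all have the same sign, as those of the twisted annulus, is therefore
  homogeneous.
\<close>

lemma edges_block: "B \<in> blocks G \<Longrightarrow> edges B \<subseteq> edges G"
  by (auto simp: blocks_def blocks_of_connected_def induced_def)

lemma homogeneous_twisted_annulus: "homogeneous_diagram twisted_annulus"
proof -
  have "positive x" if "B \<in> blocks (seifert_graph twisted_annulus)" "x \<in> edges B" for B x
    using edges_block[OF that(1)] that(2) by (auto simp: seifert_graph_def twisted_annulus_def)
  then show ?thesis by (simp add: homogeneous_diagram_def oriented_twisted_annulus)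
qed

text \<open>
  Going once around the diagram leaves the obstruction \<open>2 t (t - 1)\<close>, a multiple of the
  Alexander polynomial.
\<close>

lemma not_monochromatic_twisted_annulus:
  fixes t :: "'k::field"
  assumes "(2::'k) = 0"
  shows "\<not> monochromatic t twisted_annulus"
proof
  define x :: "nat \<Rightarrow> 'k" where
    "x a = (if a \<in> {0, 1} then 1 else if a \<in> {2, 3} then t else if a \<in> {5, 6} then 0 else 1 - t)" for a
  have "t * (1 - t) + (1 - t) * t = 2 * (t * (1 - t))" "t * t + (1 - t) * (1 - t) = 1 + 2 * (t * (t - 1))"
    by (simp_all add: algebra_simps)
  then have "coloring t twisted_annulus x"
    using assms by (simp add: twisted_annulus_def x_def pass_under_def)
  moreover assume "monochromatic t twisted_annulus"
  ultimately obtain k where "\<forall>a\<in>arcs twisted_annulus. x a = k"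
    unfolding monochromatic_def by blast
  then have "x 0 = x 5"
    by (simp add: arcs_twisted_annulus)
  then show False by (simp add: x_def)
qed

text \<open>
  At \<open>t = -1\<close> passing under a strand is reflection in its color.  The reflections leave
  \<open>4 (x 6 - x 0) = 0\<close>, where \<open>4\<close> is the determinant of the link.
\<close>

lemma monochromatic_twisted_annulus: "monochromatic (- 1 :: rat) twisted_annulus"
  unfolding monochromatic_def
proof (intro allI impI)
  have reflect: "pass_under (- 1) True a c = 2 * a - c" for a c :: rat
    by (simp add: pass_under_def)
  fix x :: "nat \<Rightarrow> rat" assume "coloring (- 1) twisted_annulus x"
  then have "x 1 = x 0 \<and> x 4 = 2 * x 0 - x 5 \<and> x 5 = x 6 \<and> x 2 = 2 * x 6 - x 1 \<and>
      x 3 = x 2 \<and> x 6 = 2 * x 2 - x 7 \<and> x 7 = x 4 \<and> x 0 = 2 * x 4 - x 3"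
    unfolding twisted_annulus_def coloring_add_mset node_rule.simps reflect by blast
  then have "x 1 = x 0" "x 2 = x 0" "x 3 = x 0" "x 4 = x 0" "x 5 = x 0" "x 6 = x 0" "x 7 = x 0"
    by linarith+
  then show "\<exists>k. \<forall>a\<in>arcs twisted_annulus. x a = k"
    unfolding arcs_twisted_annulus by simp
qed

lemma two_bit_fls: "(2 :: bit fls) = 0"
proof -
  have "fls_const (2 :: bit) = 0" by simp
  then show ?thesis using fls_const_numeral by metis
qed

section \<open>The twisted annulus is not a closed homogeneous braid\<close>

lemma braid_representatives:
  assumes "\<beta> \<in> braids n" "w \<in> \<beta>" "w' \<in> \<beta>"
  shows "w \<in> braid_words n" and "equivclp (braid_relation n) w w'"
proof -
  obtain v where "equivclp (braid_relation n) v w" "equivclp (braid_relation n) v w'"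
    and w: "w \<in> braid_words n"
    using assms unfolding braids_def by (elim quotientE) auto
  then show "equivclp (braid_relation n) w w'"
    by (meson equivclp_sym equivclp_trans)
  show "w \<in> braid_words n" by (rule w)
qed

text \<open>
  The diagram \<open>D\<close> is equivalent to the closure of some word of the braid, which need not be the
  word \<open>w\<close> of interest.  The Burau action carries the criterion from one word to the other.
\<close>

lemma monochromatic_braid_closure_iff:
  assumes \<beta>: "\<beta> \<in> braids n" and D: "D \<in> braid_closure n \<beta>" and w: "w \<in> \<beta>" and t: "t \<noteq> 0"
  shows "monochromatic t D \<longleftrightarrow>
    (\<forall>v. (\<forall>p\<in>{1..n}. burau t w v p = v p) \<longrightarrow> (\<exists>k. \<forall>p\<in>{1..n}. v p = k))"
proof -
  obtain w' where w': "w' \<in> \<beta>" and link: "same_link (closure_diagram n w') D"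
    using D by (auto simp: braid_closure_def link_of_def)
  have "burau t w' = burau t w"
    using braid_representatives(2)[OF \<beta> w' w] burau_braid_relation[OF _ t]
    by (rule equivclp_invariant)
  moreover have "w' \<in> braid_words n"
    using braid_representatives(1)[OF \<beta> w' w] .
  ultimately show ?thesis
    using same_link_monochromatic[OF link t] monochromatic_closure_iff[OF _ t] by metis
qed

theorem proposition3p1:
  "\<exists>L. homogeneous_link L \<and>
       \<not> (\<exists>n\<ge>1. \<exists>\<beta>\<in>braids n. artin_homogeneous \<beta> \<and> L = braid_closure n \<beta>)"
proof (intro exI conjI notI)
  have self: "twisted_annulus \<in> link_of twisted_annulus"
    by (simp add: link_of_def same_link_def oriented_twisted_annulus)
  then show "homogeneous_link (link_of twisted_annulus)"
    using homogeneous_twisted_annulus oriented_twisted_annulus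
    unfolding homogeneous_link_def oriented_links_def by blast
  assume "\<exists>n\<ge>1. \<exists>\<beta>\<in>braids n. artin_homogeneous \<beta> \<and> link_of twisted_annulus = braid_closure n \<beta>"
  then obtain n \<beta> w where \<beta>: "\<beta> \<in> braids n" and w: "w \<in> \<beta>" "homogeneous_word w"
    and closure: "twisted_annulus \<in> braid_closure n \<beta>"
    using self unfolding artin_homogeneous_def by blast
  show False
  proof (cases "\<forall>i. 1 \<le> i \<longrightarrow> i < n \<longrightarrow> (\<exists>s. (i, s) \<in> set w)")
    case True
    have "monochromatic (fls_X :: bit fls) twisted_annulus"
      unfolding monochromatic_braid_closure_iff[OF \<beta> closure w(1) fls_X_nonzero]
      using full_homogeneous_fixed_constant[OF braid_representatives(1)[OF \<beta> w(1) w(1)] w(2)] True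
      by blast
    then show False
      using not_monochromatic_twisted_annulus[OF two_bit_fls] by blast
  next
    case False
    then obtain i where i: "1 \<le> i" "i < n" "\<forall>s. (i, s) \<notin> set w" by blast
    let ?v = "\<lambda>p. if p \<le> i then 0 else 1 :: rat"
    have "\<forall>p\<in>{1..n}. burau (- 1) w ?v p = ?v p"
      using burau_missing_generator[of "- 1 :: rat" i w] i(3) by simp
    moreover have "\<forall>v. (\<forall>p\<in>{1..n}. burau (- 1 :: rat) w v p = v p) \<longrightarrow> (\<exists>k. \<forall>p\<in>{1..n}. v p = k)"
      using monochromatic_twisted_annulus
        monochromatic_braid_closure_iff[OF \<beta> closure w(1), of "- 1 :: rat"] by simp
    ultimately obtain k where k: "\<forall>p\<in>{1..n}. ?v p = k"
      by blast
    have "?v i = k" "?v (i + 1) = k"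
      by (rule bspec[OF k], use i in simp)+
    then show False by simp
  qed
qed

end
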